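(* Let $p$ be an odd prime and $m\in\mathbb{Z}_p$ with $m\not\equiv0,16,-16\pmod p$. Then $$\sum_{n=0}^{p-1}\frac{V_n}{m^n}\equiv\sum_{k=0}^{p-1}\binom{2k}{k}\frac{G_k}{(32+m+256/m)^k}\equiv\sum_{k=0}^{\frac{p-1}{2}}\frac{\binom{2k}{k}^3}{(32-m-256/m)^k}\pmod p.$$
   Context: $\mathbb{Z}_p$ denotes the set of rationals whose denominator is not divisible by $p$; congruences are in this ring. For $n\ge0$, $G_n=\sum_{k=0}^n \binom{2k}{k}^2\binom{2n-2k}{n-k}4^{n-k}$ and $V_n=\sum_{k=0}^n\binom{2k}{k}^2\binom{2n-2k}{n-k}^2$. *)

theory Defs
  imports Complex_Main "HOL-Computational_Algebra.Primes"
begin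

(* quotient_of returns the fraction in lowest terms with positive denominator. *)
definition Z_loc :: "nat \<Rightarrow> rat set" where
  "Z_loc p = {x. \<not> int p dvd snd (quotient_of x)}"

(* Congruence modulo p in the ring Z_loc p; in particular both sides have to lie in that ring. *)
definition cong_loc :: "nat \<Rightarrow> rat \<Rightarrow> rat \<Rightarrow> bool" where
  "cong_loc p x y \<longleftrightarrow> x \<in> Z_loc p \<and> y \<in> Z_loc p \<and> (\<exists>z\<in>Z_loc p. x - y = of_nat p * z)"

definition G :: "nat \<Rightarrow> nat" where
  "G n = (\<Sum>k=0..n. ((2 * k) choose k)^2 * ((2 * n - 2 * k) choose (n - k)) * 4^(n - k))"

definition V :: "nat \<Rightarrow> nat" where
  "V n = (\<Sum>k=0..n. ((2 * k) choose k)^2 * ((2 * n - 2 * k) choose (n - k))^2)"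

end

theory Submission
  imports Defs
begin

text \<open>
  Both congruences come from expansions of \<open>V\<close> in the functions \<open>n \<mapsto> (n + k) choose (2 * k)\<close>,
    \<open>V n = (\<Sum>k\<le>n. ((n + k) choose (2 * k)) * e k * c ^ (n - k))\<close>,
  once with \<open>c = 16\<close> and \<open>e k = (-1) ^ k * (2 * k choose k) ^ 3\<close>, and once with \<open>c = -16\<close> and
  \<open>e k = (2 * k choose k) * G k\<close>. Each side satisfies the same second-order recurrence, by creative
  telescoping.

  Put \<open>t = c / m\<close>. For \<open>2 * k < p\<close> the function \<open>n \<mapsto> (n + k) choose (2 * k)\<close> has period \<open>p\<close>
  modulo \<open>p\<close>, so by Fermat the sum of \<open>((n + k) choose (2 * k)) * t ^ (n - k)\<close> over one period is
  congruent to \<open>(1 - t) ^ (- 2 * k)\<close>, as if it were the full power series; for larger \<open>k\<close> the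
  factor \<open>2 * k choose k\<close> of \<open>e k\<close> vanishes modulo \<open>p\<close>. Since \<open>m * (1 - t)\<^sup>2 = m - 2 * c + 256 / m\<close>,
  summing \<open>V n / m ^ n\<close> gives the two right-hand sides.
\<close>

section \<open>Recurrences by creative telescoping\<close>

definition central_binomial :: "nat \<Rightarrow> rat" where
  "central_binomial k = of_nat ((2 * k) choose k)"

lemma central_binomial_Suc:
  "(of_nat k + 1) * central_binomial (Suc k) = 2 * (2 * of_nat k + 1) * central_binomial k"
proof -
  let ?k = "of_nat k :: rat"
  have "(?k + 1) * central_binomial (Suc k) = 2 * ((?k + 1) * (2 * ?k + 1 gchoose k))"
    using gbinomial_absorption[of k "2 * ?k + 2"]
    by (simp add: central_binomial_def binomial_gbinomial algebra_simps del: binomial_Suc_Suc)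
  also have "(?k + 1) * (2 * ?k + 1 gchoose k) = (2 * ?k + 1) * central_binomial k"
    using gbinomial_absorb_comp[of "2 * ?k + 1" k]
    by (simp add: central_binomial_def binomial_gbinomial)
  finally show ?thesis
    by simp
qed

definition binomial_diag :: "nat \<Rightarrow> nat \<Rightarrow> rat" where
  "binomial_diag n k = of_nat ((n + k) choose (2 * k))"

lemma binomial_diag_eq_0: "n < k \<Longrightarrow> binomial_diag n k = 0"
  by (simp add: binomial_diag_def)

lemma binomial_diag_Suc_left:
  "(of_nat n + 1 - of_nat k) * binomial_diag (Suc n) k = (of_nat n + 1 + of_nat k) * binomial_diag n k"
  using gbinomial_absorb_comp[of "of_nat (Suc n + k) :: rat" "2 * k"]
  by (simp add: binomial_diag_def binomial_gbinomial algebra_simps)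

lemma binomial_diag_Suc_right:
  "2 * (2 * of_nat k + 1) * (of_nat k + 1) * binomial_diag n (Suc k)
     = (of_nat n - of_nat k) * (of_nat n + of_nat k + 1) * binomial_diag n k"
proof -
  let ?k = "of_nat k :: rat" and ?a = "of_nat n + of_nat k :: rat"
  have "2 * (?k + 1) * binomial_diag n (Suc k) = (?a + 1) * (?a gchoose (2 * k + 1))"
    using gbinomial_absorption[of "2 * k + 1" "?a + 1"]
    by (simp add: binomial_diag_def binomial_gbinomial algebra_simps del: binomial_Suc_Suc)
  moreover have "(2 * ?k + 1) * (?a gchoose (2 * k + 1)) = (of_nat n - ?k) * binomial_diag n k"
    using gbinomial_mult_1[of ?a "2 * k"]
    by (simp add: binomial_diag_def binomial_gbinomial algebra_simps)
  ultimately show ?thesis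
    by algebra
qed

text \<open>The divisor \<open>(n + 1 + k) * (n + 2 + k)\<close> is never zero, so \<open>y\<close>
  is a legitimate common factor of the three values for every \<open>k\<close>, including
  \<open>k = n + 1\<close> and \<open>k = n + 2\<close>, where a quotient of neighbouring values
  would break down. With it a telescoping equation becomes a polynomial identity.\<close>

lemma binomial_diag_common_factor:
  fixes n k :: nat
  defines "y \<equiv> binomial_diag (n + 2) k / ((of_nat n + 1 + of_nat k) * (of_nat n + 2 + of_nat k))"
  shows "binomial_diag (n + 2) k = (of_nat n + 1 + of_nat k) * (of_nat n + 2 + of_nat k) * y"
    and "binomial_diag (n + 1) k = (of_nat n + 2 - of_nat k) * (of_nat n + 1 + of_nat k) * y"
    and "binomial_diag n k = (of_nat n + 2 - of_nat k) * (of_nat n + 1 - of_nat k) * y"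
proof -
  let ?n = "of_nat n :: rat" and ?k = "of_nat k :: rat"
  have nz: "?n + 1 + ?k \<noteq> 0" "?n + 2 + ?k \<noteq> 0"
    using of_nat_0_le_iff[of n, where 'a = rat] of_nat_0_le_iff[of k, where 'a = rat] by linarith+
  show 2: "binomial_diag (n + 2) k = (?n + 1 + ?k) * (?n + 2 + ?k) * y"
    using nz by (simp add: y_def)
  have "(?n + 2 + ?k) * binomial_diag (n + 1) k = (?n + 2 - ?k) * binomial_diag (n + 2) k"
    using binomial_diag_Suc_left[of "Suc n" k] by (simp add: algebra_simps)
  also have "\<dots> = (?n + 2 + ?k) * ((?n + 2 - ?k) * (?n + 1 + ?k) * y)"
    unfolding 2 by algebra
  finally show 1: "binomial_diag (n + 1) k = (?n + 2 - ?k) * (?n + 1 + ?k) * y"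
    by (rule mult_left_cancel[THEN iffD1, OF nz(2)])
  have "(?n + 1 + ?k) * binomial_diag n k = (?n + 1 - ?k) * binomial_diag (n + 1) k"
    using binomial_diag_Suc_left[of n k] by simp
  also have "\<dots> = (?n + 1 + ?k) * ((?n + 2 - ?k) * (?n + 1 - ?k) * y)"
    unfolding 1 by algebra
  finally show "binomial_diag n k = (?n + 2 - ?k) * (?n + 1 - ?k) * y"
    by (rule mult_left_cancel[THEN iffD1, OF nz(1)])
qed

text \<open>This brings the shifted term \<open>T (Suc k)\<close> of a certificate back to the
  common factor at \<open>k\<close>. It is \<open>binomial_diag_Suc_right\<close> at
  \<open>n + 2\<close> with \<open>(n + 2 + k) * (n + 3 + k)\<close> cancelled.\<close>

lemma binomial_diag_quotient_Suc:
  fixes n :: nat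
  defines "y \<equiv> \<lambda>k. binomial_diag (n + 2) k / ((of_nat n + 1 + of_nat k) * (of_nat n + 2 + of_nat k))"
  shows "2 * (2 * of_nat k + 1) * (of_nat k + 1) * y (Suc k)
    = (of_nat n + 2 - of_nat k) * (of_nat n + 1 + of_nat k) * y k"
proof -
  let ?n = "of_nat n :: rat" and ?k = "of_nat k :: rat"
  have nz: "?n + 1 + ?k \<noteq> 0" "?n + 2 + ?k \<noteq> 0" "?n + 3 + ?k \<noteq> 0"
    using of_nat_0_le_iff[of n, where 'a = rat] of_nat_0_le_iff[of k, where 'a = rat] by linarith+
  have 1: "binomial_diag (n + 2) (Suc k) = (?n + 2 + ?k) * (?n + 3 + ?k) * y (Suc k)"
    using binomial_diag_common_factor(1)[of n "Suc k"] by (simp add: y_def algebra_simps)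
  have 0: "binomial_diag (n + 2) k = (?n + 1 + ?k) * (?n + 2 + ?k) * y k"
    using binomial_diag_common_factor(1)[of n k] by (simp add: y_def)
  have "((?n + 2 + ?k) * (?n + 3 + ?k)) * (2 * (2 * ?k + 1) * (?k + 1) * y (Suc k))
      = 2 * (2 * ?k + 1) * (?k + 1) * binomial_diag (n + 2) (Suc k)"
    unfolding 1 by algebra
  also have "\<dots> = (?n + 2 - ?k) * (?n + 3 + ?k) * binomial_diag (n + 2) k"
    using binomial_diag_Suc_right[of k "n + 2"] by (simp add: algebra_simps)
  also have "\<dots> = ((?n + 2 + ?k) * (?n + 3 + ?k)) * ((?n + 2 - ?k) * (?n + 1 + ?k) * y k)"
    unfolding 0 by algebra
  finally show ?thesis
    by (rule mult_left_cancel[THEN iffD1, rotated]) (use nz in simp)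
qed

section \<open>Creative telescoping and the recurrences of \<open>V\<close> and
  \<open>G\<close>\<close>

text \<open>Since \<open>f i k\<close> vanishes for \<open>k > i\<close>, all three sums may run
  over \<open>k < n + 3\<close>; the combination then collapses to \<open>T (n + 3) - T 0\<close>.
  The function \<open>T\<close> is the certificate.\<close>

lemma telescoped_recurrence:
  fixes f :: "nat \<Rightarrow> nat \<Rightarrow> 'a::comm_ring_1"
  assumes "\<And>i k. i < k \<Longrightarrow> f i k = 0"
    and "\<And>k. a * f (n + 2) k + b * f (n + 1) k + c * f n k = T (Suc k) - T k"
    and "T 0 = 0" and "T (n + 3) = 0"
  shows "a * (\<Sum>k\<le>n + 2. f (n + 2) k) + b * (\<Sum>k\<le>n + 1. f (n + 1) k) + c * (\<Sum>k\<le>n. f n k) = 0"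
proof -
  define N where "N = n + 3"
  have ext: "(\<Sum>k\<le>i. f i k) = (\<Sum>k<N. f i k)" if "i \<le> n + 2" for i
    by (rule sum.mono_neutral_left) (use assms(1) that in \<open>auto simp: N_def\<close>)
  have "a * (\<Sum>k\<le>n + 2. f (n + 2) k) + b * (\<Sum>k\<le>n + 1. f (n + 1) k) + c * (\<Sum>k\<le>n. f n k)
      = (\<Sum>k<N. a * f (n + 2) k + b * f (n + 1) k + c * f n k)"
    by (simp only: ext sum.distrib sum_distrib_left le_refl le_add1 add_left_mono one_le_numeral)
  also have "\<dots> = (\<Sum>k<N. T (Suc k) - T k)"
    by (simp only: assms(2))
  also have "\<dots> = T N - T 0"
    by (rule sum_lessThan_telescope)
  finally show ?thesis
    by (simp only: N_def assms(3,4) diff_self)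
qed

text \<open>With \<open>N = n + 1\<close> this is the Apery-like recurrence \<open>(N + 1)^3 * g (N
  + 1) = (2 * N + 1) * (16 * N^2 + 16 * N + 8) * g N - 256 * N^3 * g (N - 1)\<close>, shifted to
  avoid subtraction on indices.\<close>

definition V_recurrence :: "(nat \<Rightarrow> rat) \<Rightarrow> bool" where
  "V_recurrence g \<longleftrightarrow> (\<forall>n. (of_nat n + 2)^3 * g (n + 2)
     - 8 * (2 * of_nat n + 3) * (2 * of_nat n^2 + 6 * of_nat n + 5) * g (n + 1)
     + 256 * (of_nat n + 1)^3 * g n = 0)"

text \<open>The leading coefficient \<open>(n + 2)^3\<close> is never zero over the rationals, so
  each value is determined by the two before it.\<close>

lemma V_recurrence_unique:
  assumes "V_recurrence f" "V_recurrence g" "f 0 = g 0" "f 1 = g 1"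
  shows "f n = g n"
proof (induction n rule: less_induct)
  case (less n)
  consider "n = 0" | "n = 1" | k where "n = k + 2"
    by (metis One_nat_def add_2_eq_Suc' not0_implies_Suc)
  then show ?case
  proof cases
    case 3
    have eq: "f k = g k" "f (k + 1) = g (k + 1)"
      using less 3 by auto
    have "(of_nat k + 2 :: rat)^3 * f (k + 2) = (of_nat k + 2)^3 * g (k + 2)"
      using assms(1,2)[unfolded V_recurrence_def, rule_format, of k] unfolding eq by linarith
    moreover have "(of_nat k + 2 :: rat) \<noteq> 0"
      using of_nat_0_le_iff[of k, where 'a = rat] by linarith
    ultimately show ?thesis
      using 3 by simp
  qed (use assms in auto)
qed

lemma odd_offset_nonzero: "2 * of_nat n + 1 - 2 * of_nat k \<noteq> (0::rat)"
proof
  assume "2 * of_nat n + 1 - 2 * of_nat k = (0::rat)"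
  then have "(of_nat (2 * n + 1) :: rat) = of_nat (2 * k)"
    by simp
  then show False
    by (subst (asm) of_nat_eq_iff) presburger
qed

text \<open>Extending by zero beyond \<open>k = n\<close> preserves the recurrence: at
  \<open>k = n + 1\<close> the left factor is zero and so is \<open>c n\<close>. Hence it can be
  used for every \<open>k\<close> in a telescoping argument.\<close>

lemma central_binomial_rev_Suc:
  fixes n k :: nat
  defines "c \<equiv> \<lambda>n. if k \<le> n then central_binomial (n - k) else 0"
  shows "(of_nat n + 1 - of_nat k) * c (Suc n) = 2 * (2 * of_nat n + 1 - 2 * of_nat k) * c n"
proof (cases "k \<le> n")
  case True
  then obtain j where j: "n = k + j"
    using le_Suc_ex by blast
  have "c (Suc n) = central_binomial (Suc j)" "c n = central_binomial j"
    by (simp_all add: c_def j Suc_diff_le)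
  then show ?thesis
    using central_binomial_Suc[of j] by (simp add: j)
next
  case False
  then have "k = Suc n \<or> Suc n < k" by auto
  then show ?thesis by (auto simp: c_def)
qed

lemma V_recurrence_V: "V_recurrence (\<lambda>n. of_nat (V n))"
  unfolding V_recurrence_def
proof
  fix n
  define c where "c = (\<lambda>n k. if k \<le> n then central_binomial (n - k) else 0)"
  define f where "f = (\<lambda>n k. central_binomial k^2 * c n k^2)"
  have V: "of_nat (V i) = (\<Sum>k\<le>i. f i k)" for i
    unfolding V_def of_nat_sum atMost_atLeast0
    by (rule sum.cong) (auto simp: f_def c_def central_binomial_def right_diff_distrib')
  let ?n = "of_nat n :: rat"
  \<comment> \<open>The certificate \<open>u\<close>, like the others below, was found by solving the telescoping equation for a polynomial
    with undetermined coefficients.\<close>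
  define u where "u = (\<lambda>k::rat. 4 * ?n^2 - 4 * ?n * k + 13 * ?n - 6 * k + 10)"
  define T where "T = (\<lambda>k. u (of_nat k) * of_nat k^2 * central_binomial k^2 * c (n + 2) k^2
     / (2 * ?n + 3 - 2 * of_nat k)^2)"
  have "(?n + 2)^3 * f (n + 2) k
     + - (8 * (2 * ?n + 3) * (2 * ?n^2 + 6 * ?n + 5)) * f (n + 1) k
     + 256 * (?n + 1)^3 * f n k = T (Suc k) - T k" for k
  proof -
    let ?k = "of_nat k :: rat"
    define d3 d1 where "d3 = 2 * ?n + 3 - 2 * ?k" and "d1 = 2 * ?n + 1 - 2 * ?k"
    have nz: "d3 \<noteq> 0" "d1 \<noteq> 0"
      using odd_offset_nonzero[of n k] odd_offset_nonzero[of "Suc n" k] by (auto simp: d3_def d1_def)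
    \<comment> \<open>The odd numbers \<open>d3\<close> and \<open>d1\<close> may be divided by for
      every \<open>k\<close>, unlike \<open>n + 1 - k\<close> and \<open>n + 2 - k\<close>. So
      \<open>y\<close> is a common factor of the three values of \<open>c\<close> with polynomial
      cofactors.\<close>
    define y where "y = c (n + 2) k / (4 * d3 * d1)"
    have c2: "c (n + 2) k = 4 * d3 * d1 * y"
      using nz by (simp add: y_def)
    have "2 * d3 * c (n + 1) k = (?n + 2 - ?k) * c (n + 2) k"
      using central_binomial_rev_Suc[of "Suc n" k] by (simp add: c_def d3_def algebra_simps)
    also have "\<dots> = 2 * d3 * (2 * (?n + 2 - ?k) * d1 * y)"
      unfolding c2 by algebra
    finally have c1: "c (n + 1) k = 2 * (?n + 2 - ?k) * d1 * y"
      by (rule mult_left_cancel[THEN iffD1, rotated]) (use nz in simp)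
    have "2 * d1 * c n k = (?n + 1 - ?k) * c (n + 1) k"
      using central_binomial_rev_Suc[of n k] by (simp add: c_def d1_def algebra_simps)
    also have "\<dots> = 2 * d1 * ((?n + 2 - ?k) * (?n + 1 - ?k) * y)"
      unfolding c1 by algebra
    finally have c0: "c n k = (?n + 2 - ?k) * (?n + 1 - ?k) * y"
      by (rule mult_left_cancel[THEN iffD1, rotated]) (use nz in simp)
    have T0: "T k = u ?k * ?k^2 * central_binomial k^2 * (4 * d1 * y)^2"
      unfolding T_def c2 d3_def[symmetric] using nz by (simp add: power_mult_distrib)
    \<comment> \<open>\<open>c n k\<close> depends only on \<open>n - k\<close>, so raising
      \<open>k\<close> by one amounts to lowering \<open>n\<close> by one.\<close>
    have s: "of_nat (Suc k) = ?k + 1" "c (n + 2) (Suc k) = c (n + 1) k" "2 * ?n + 3 - 2 * (?k + 1) = d1"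
      by (simp_all add: c_def d1_def)
    have "T (Suc k) = u (?k + 1) * ((?k + 1) * central_binomial (Suc k))^2 * c (n + 1) k^2 / d1^2"
      unfolding T_def s by (simp add: power_mult_distrib)
    also have "\<dots> = u (?k + 1) * (2 * (2 * ?k + 1) * central_binomial k)^2 * (2 * (?n + 2 - ?k) * y)^2"
      unfolding central_binomial_Suc c1 using nz by (simp add: power_mult_distrib)
    finally have T1: "T (Suc k) = u (?k + 1) * (2 * (2 * ?k + 1) * central_binomial k)^2 * (2 * (?n + 2 - ?k) * y)^2" .
    show ?thesis
      unfolding T0 T1 f_def c0 c1 c2 u_def d3_def d1_def by algebra
  qed
  then have "(?n + 2)^3 * of_nat (V (n + 2))
     + - (8 * (2 * ?n + 3) * (2 * ?n^2 + 6 * ?n + 5)) * of_nat (V (n + 1))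
     + 256 * (?n + 1)^3 * of_nat (V n) = 0"
    unfolding V by (rule telescoped_recurrence[rotated]) (simp_all add: f_def c_def T_def)
  then show "(?n + 2)^3 * of_nat (V (n + 2))
     - 8 * (2 * ?n + 3) * (2 * ?n^2 + 6 * ?n + 5) * of_nat (V (n + 1))
     + 256 * (?n + 1)^3 * of_nat (V n) = 0"
    by (simp only: diff_conv_add_uminus mult_minus_left)
qed

text \<open>Same method as for \<open>V\<close>; here the certificate is just
  \<open>k^2 / (2 * n + 3 - 2 * k)\<close> times the summand at \<open>n + 2\<close>.\<close>

lemma G_recurrence_Suc:
  "(of_nat n + 2)^2 * of_nat (G (n + 2))
     - (32 * (of_nat n + 1)^2 + 32 * (of_nat n + 1) + 12) * of_nat (G (n + 1))
     + 256 * (of_nat n + 1)^2 * of_nat (G n) = (0 :: rat)"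
proof -
  define c where "c = (\<lambda>n k. if k \<le> n then central_binomial (n - k) else 0)"
  \<comment> \<open>Writing \<open>4^n / 4^k\<close> for \<open>4^(n - k)\<close> turns shifts of
    \<open>n\<close> and \<open>k\<close> into plain factors; for \<open>k > n\<close> the factor
    \<open>c n k\<close> is zero.\<close>
  define f where "f = (\<lambda>n k. central_binomial k^2 * c n k * 4^n / 4^k)"
  have G: "of_nat (G i) = (\<Sum>k\<le>i. f i k)" for i
    unfolding G_def of_nat_sum atMost_atLeast0
    by (rule sum.cong) (auto simp: f_def c_def central_binomial_def right_diff_distrib' power_diff[where 'a = rat])
  let ?n = "of_nat n :: rat"
  define T where "T = (\<lambda>k. of_nat k^2 * central_binomial k^2 * c (n + 2) k * 4^(n + 2) / 4^k
     / (2 * ?n + 3 - 2 * of_nat k))"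
  have "(?n + 2)^2 * f (n + 2) k
     + - (32 * (?n + 1)^2 + 32 * (?n + 1) + 12) * f (n + 1) k
     + 256 * (?n + 1)^2 * f n k = T (Suc k) - T k" for k
  proof -
    let ?k = "of_nat k :: rat"
    define d3 d1 where "d3 = 2 * ?n + 3 - 2 * ?k" and "d1 = 2 * ?n + 1 - 2 * ?k"
    have nz: "d3 \<noteq> 0" "d1 \<noteq> 0"
      using odd_offset_nonzero[of n k] odd_offset_nonzero[of "Suc n" k] by (auto simp: d3_def d1_def)
    define y where "y = c (n + 2) k / (4 * d3 * d1)"
    have c2: "c (n + 2) k = 4 * d3 * d1 * y"
      using nz by (simp add: y_def)
    have "2 * d3 * c (n + 1) k = (?n + 2 - ?k) * c (n + 2) k"
      using central_binomial_rev_Suc[of "Suc n" k] by (simp add: c_def d3_def algebra_simps)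
    also have "\<dots> = 2 * d3 * (2 * (?n + 2 - ?k) * d1 * y)"
      unfolding c2 by algebra
    finally have c1: "c (n + 1) k = 2 * (?n + 2 - ?k) * d1 * y"
      by (rule mult_left_cancel[THEN iffD1, rotated]) (use nz in simp)
    have "2 * d1 * c n k = (?n + 1 - ?k) * c (n + 1) k"
      using central_binomial_rev_Suc[of n k] by (simp add: c_def d1_def algebra_simps)
    also have "\<dots> = 2 * d1 * ((?n + 2 - ?k) * (?n + 1 - ?k) * y)"
      unfolding c1 by algebra
    finally have c0: "c n k = (?n + 2 - ?k) * (?n + 1 - ?k) * y"
      by (rule mult_left_cancel[THEN iffD1, rotated]) (use nz in simp)
    define q where "q = (4 :: rat)^n / 4^k"
    have T0: "T k = ?k^2 * central_binomial k^2 * (64 * d1 * y) * q"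
      unfolding T_def c2 d3_def[symmetric] using nz by (simp add: q_def)
    have s: "of_nat (Suc k) = ?k + 1" "c (n + 2) (Suc k) = c (n + 1) k" "2 * ?n + 3 - 2 * (?k + 1) = d1"
      by (simp_all add: c_def d1_def)
    have "T (Suc k) = ((?k + 1) * central_binomial (Suc k))^2 * c (n + 1) k * (4 * q) / d1"
      unfolding T_def s by (simp add: power_mult_distrib q_def)
    also have "\<dots> = (2 * (2 * ?k + 1) * central_binomial k)^2 * (8 * (?n + 2 - ?k) * y) * q"
      unfolding central_binomial_Suc c1 using nz by (simp add: power_mult_distrib)
    finally have T1: "T (Suc k) = (2 * (2 * ?k + 1) * central_binomial k)^2 * (8 * (?n + 2 - ?k) * y) * q" .
    have f: "f (n + 2) k = central_binomial k^2 * c (n + 2) k * (16 * q)" "f (n + 1) k = central_binomial k^2 * c (n + 1) k * (4 * q)"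
      "f n k = central_binomial k^2 * c n k * q"
      by (simp_all add: f_def q_def)
    show ?thesis
      unfolding T0 T1 f c0 c1 c2 d3_def d1_def by algebra
  qed
  then have "(?n + 2)^2 * of_nat (G (n + 2))
     + - (32 * (?n + 1)^2 + 32 * (?n + 1) + 12) * of_nat (G (n + 1))
     + 256 * (?n + 1)^2 * of_nat (G n) = 0"
    unfolding G by (rule telescoped_recurrence[rotated]) (simp_all add: f_def c_def T_def)
  then show ?thesis
    by (simp only: diff_conv_add_uminus mult_minus_left)
qed

text \<open>This form eliminates \<open>G (Suc k)\<close> for every \<open>k\<close>. At
  \<open>k = 0\<close> the truncated \<open>k - 1\<close> is harmless because of the factor
  \<open>k^2\<close>.\<close>

lemma G_recurrence:
  "(of_nat k + 1)^2 * of_nat (G (Suc k))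
     = (32 * of_nat k^2 + 32 * of_nat k + 12) * of_nat (G k) - 256 * of_nat k^2 * (of_nat (G (k - 1)) :: rat)"
proof (cases k)
  case 0
  then show ?thesis by (simp add: G_def)
next
  case (Suc n)
  then show ?thesis
    using G_recurrence_Suc[of n] by (simp add: add_ac)
qed

section \<open>The two expansions of \<open>V\<close>\<close>

lemma V_eq_sum_cubes:
  "of_nat (V n) = (\<Sum>k\<le>n. binomial_diag n k * ((-1)^k * central_binomial k^3) * 16^(n - k))"
proof (rule V_recurrence_unique[OF V_recurrence_V])
  \<comment> \<open>The power \<open>(-1/16)^k\<close> combines the sign \<open>(-1)^k\<close> with
    the \<open>16^(- k)\<close> from \<open>16^(n - k)\<close>.\<close>
  define f where "f = (\<lambda>n k. binomial_diag n k * central_binomial k^3 * (-1/16)^k * 16^n)"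
  have S: "(\<Sum>k\<le>i. binomial_diag i k * ((-1)^k * central_binomial k^3) * 16^(i - k)) = (\<Sum>k\<le>i. f i k)" for i
    using power_divide[of "- 1 :: rat" 16] by (intro sum.cong) (auto simp: f_def power_diff)
  show "V_recurrence (\<lambda>n. \<Sum>k\<le>n. binomial_diag n k * ((-1)^k * central_binomial k^3) * 16^(n - k))"
    unfolding V_recurrence_def S
  proof
    fix n
    let ?n = "of_nat n :: rat"
    define Y where "Y = (\<lambda>k. binomial_diag (n + 2) k / ((?n + 1 + of_nat k) * (?n + 2 + of_nat k)))"
    define T where "T = (\<lambda>k. - 512 * (2 * ?n + 3) * of_nat k^4 * Y k * central_binomial k^3 * (-1/16)^k * 16^n)"
    have "(?n + 2)^3 * f (n + 2) k
       + - (8 * (2 * ?n + 3) * (2 * ?n^2 + 6 * ?n + 5)) * f (n + 1) k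
       + 256 * (?n + 1)^3 * f n k = T (Suc k) - T k" for k
    proof -
      let ?k = "of_nat k :: rat"
      have Y: "Y j = binomial_diag (n + 2) j / ((?n + 1 + of_nat j) * (?n + 2 + of_nat j))" for j
        by (simp only: Y_def)
      note y = binomial_diag_common_factor[of n k, folded Y] and Y_Suc = binomial_diag_quotient_Suc[of k n, folded Y]
      define r where "r = (-1/16::rat)^k * 16^n"
      define q where "q = central_binomial k^3 * r"
      have "T (Suc k) = - 512 * (2 * ?n + 3) * (?k + 1)^4 * Y (Suc k) * central_binomial (Suc k)^3 * ((- 1/16) * r)"
        by (simp add: T_def r_def add_ac)
      \<comment> \<open>Of the four factors \<open>k + 1\<close>, three are absorbed by the cubed
        central binomial and one by \<open>Y (Suc k)\<close>, as their recurrences require.\<close>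
      also have "\<dots> = 32 * (2 * ?n + 3) * ((?k + 1) * Y (Suc k)) * ((?k + 1) * central_binomial (Suc k))^3 * r"
        by algebra
      also have "\<dots> = 128 * (2 * ?n + 3) * (2 * ?k + 1)^2
          * (2 * (2 * ?k + 1) * (?k + 1) * Y (Suc k)) * q"
        unfolding central_binomial_Suc q_def by algebra
      also have "\<dots> = 128 * (2 * ?n + 3) * (2 * ?k + 1)^2
          * ((?n + 2 - ?k) * (?n + 1 + ?k) * Y k) * q"
        by (simp only: Y_Suc)
      finally have T1: "T (Suc k) = 128 * (2 * ?n + 3) * (2 * ?k + 1)^2
          * ((?n + 2 - ?k) * (?n + 1 + ?k) * Y k) * q" .
      have T0: "T k = - 512 * (2 * ?n + 3) * ?k^4 * Y k * q"
        by (simp add: T_def q_def r_def)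
      have f: "f (n + 2) k = binomial_diag (n + 2) k * 256 * q" "f (n + 1) k = binomial_diag (n + 1) k * 16 * q"
        "f n k = binomial_diag n k * q"
        by (simp_all add: f_def q_def r_def)
      show ?thesis
        unfolding T0 T1 f y by algebra
    qed
    then have "(?n + 2)^3 * (\<Sum>k\<le>n + 2. f (n + 2) k)
       + - (8 * (2 * ?n + 3) * (2 * ?n^2 + 6 * ?n + 5)) * (\<Sum>k\<le>n + 1. f (n + 1) k)
       + 256 * (?n + 1)^3 * (\<Sum>k\<le>n. f n k) = 0"
      by (rule telescoped_recurrence[rotated]) (simp_all add: f_def T_def Y_def binomial_diag_eq_0)
    then show "(?n + 2)^3 * (\<Sum>k\<le>n + 2. f (n + 2) k)
       - 8 * (2 * ?n + 3) * (2 * ?n^2 + 6 * ?n + 5) * (\<Sum>k\<le>n + 1. f (n + 1) k)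
       + 256 * (?n + 1)^3 * (\<Sum>k\<le>n. f n k) = 0"
      by (simp only: diff_conv_add_uminus mult_minus_left)
  qed
qed (simp_all add: V_def binomial_diag_def central_binomial_def numeral_2_eq_2)

text \<open>The summand involves \<open>G\<close>, which satisfies only a second-order recurrence,
  so the certificate combines \<open>G k\<close> and \<open>G (k - 1)\<close>, and
  \<open>G_recurrence\<close> removes \<open>G (Suc k)\<close> from its shift. Both sides start with
  1 and 8.\<close>

lemma V_eq_sum_G:
  "of_nat (V n) = (\<Sum>k\<le>n. binomial_diag n k * (central_binomial k * of_nat (G k)) * (-16)^(n - k))"
proof (rule V_recurrence_unique[OF V_recurrence_V])
  \<comment> \<open>Here \<open>-1/16\<close> is simply the inverse of the base \<open>-16\<close>;
    the coefficient carries no sign.\<close>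
  define f where "f = (\<lambda>n k. binomial_diag n k * central_binomial k * of_nat (G k) * (-1/16)^k * (-16)^n)"
  have S: "(\<Sum>k\<le>i. binomial_diag i k * (central_binomial k * of_nat (G k)) * (-16)^(i - k)) = (\<Sum>k\<le>i. f i k)" for i
    using power_divide[of "1 :: rat" "- 16"] by (intro sum.cong) (auto simp: f_def power_diff)
  show "V_recurrence (\<lambda>n. \<Sum>k\<le>n. binomial_diag n k * (central_binomial k * of_nat (G k)) * (-16)^(n - k))"
    unfolding V_recurrence_def S
  proof
    fix n
    let ?n = "of_nat n :: rat"
    define Y where "Y = (\<lambda>k. binomial_diag (n + 2) k / ((?n + 1 + of_nat k) * (?n + 2 + of_nat k)))"
    \<comment> \<open>The coefficient of \<open>G (k - 1)\<close> is forced: it cancels the term that the recurrence for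
      \<open>G (Suc k)\<close> contributes to \<open>T (Suc k)\<close>.\<close>
    define T where "T = (\<lambda>k. - 512 * (2 * ?n + 3) * of_nat k^2 * Y k * central_binomial k
        * (of_nat k^2 * of_nat (G k)
          + 16 * (?n + 2 - of_nat k) * (?n + 1 + of_nat k) * of_nat (G (k - 1)))
        * (-1/16)^k * (-16)^n)"
    have "(?n + 2)^3 * f (n + 2) k
       + - (8 * (2 * ?n + 3) * (2 * ?n^2 + 6 * ?n + 5)) * f (n + 1) k
       + 256 * (?n + 1)^3 * f n k = T (Suc k) - T k" for k
    proof -
      let ?k = "of_nat k :: rat"
      have Y: "Y j = binomial_diag (n + 2) j / ((?n + 1 + of_nat j) * (?n + 2 + of_nat j))" for j
        by (simp only: Y_def)
      note y = binomial_diag_common_factor[of n k, folded Y] and Y_Suc = binomial_diag_quotient_Suc[of k n, folded Y]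
      define r where "r = (-1/16::rat)^k * (-16)^n"
      define q where "q = central_binomial k * r"
      define H where "H = (?k + 1)^2 * of_nat (G (Suc k))
          + 16 * (?n + 1 - ?k) * (?n + 2 + ?k) * of_nat (G k)"
      have h: "?n + 2 - (?k + 1) = ?n + 1 - ?k" "?n + 1 + (?k + 1) = ?n + 2 + ?k"
        and s: "of_nat (Suc k) = ?k + 1"
        by simp_all
      have "T (Suc k) = - 512 * (2 * ?n + 3) * (?k + 1)^2 * Y (Suc k) * central_binomial (Suc k) * H * ((- 1/16) * r)"
        unfolding T_def s h H_def r_def by simp
      also have "\<dots> = 32 * (2 * ?n + 3) * ((?k + 1) * Y (Suc k)) * ((?k + 1) * central_binomial (Suc k)) * H * r"
        by algebra
      also have "\<dots> = 32 * (2 * ?n + 3) * (2 * (2 * ?k + 1) * (?k + 1) * Y (Suc k)) * H * q"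
        unfolding central_binomial_Suc q_def by algebra
      also have "\<dots> = 32 * (2 * ?n + 3) * ((?n + 2 - ?k) * (?n + 1 + ?k) * Y k) * H * q"
        by (simp only: Y_Suc)
      finally have T1: "T (Suc k)
          = 32 * (2 * ?n + 3) * ((?n + 2 - ?k) * (?n + 1 + ?k) * Y k) * H * q" .
      have T0: "T k = - 512 * (2 * ?n + 3) * ?k^2 * Y k * (?k^2 * of_nat (G k)
          + 16 * (?n + 2 - ?k) * (?n + 1 + ?k) * of_nat (G (k - 1))) * q"
        by (simp add: T_def q_def r_def)
      have f: "f (n + 2) k = binomial_diag (n + 2) k * 256 * (of_nat (G k) * q)"
        "f (n + 1) k = - (binomial_diag (n + 1) k * 16 * (of_nat (G k) * q))"
        "f n k = binomial_diag n k * (of_nat (G k) * q)"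
        by (simp_all add: f_def q_def r_def)
      show ?thesis
        unfolding T0 T1 f y H_def G_recurrence by algebra
    qed
    then have "(?n + 2)^3 * (\<Sum>k\<le>n + 2. f (n + 2) k)
       + - (8 * (2 * ?n + 3) * (2 * ?n^2 + 6 * ?n + 5)) * (\<Sum>k\<le>n + 1. f (n + 1) k)
       + 256 * (?n + 1)^3 * (\<Sum>k\<le>n. f n k) = 0"
      by (rule telescoped_recurrence[rotated]) (simp_all add: f_def T_def Y_def binomial_diag_eq_0)
    then show "(?n + 2)^3 * (\<Sum>k\<le>n + 2. f (n + 2) k)
       - 8 * (2 * ?n + 3) * (2 * ?n^2 + 6 * ?n + 5) * (\<Sum>k\<le>n + 1. f (n + 1) k)
       + 256 * (?n + 1)^3 * (\<Sum>k\<le>n. f n k) = 0"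
      by (simp only: diff_conv_add_uminus mult_minus_left)
  qed
qed (simp_all add: V_def G_def binomial_diag_def central_binomial_def numeral_2_eq_2)

section \<open>The ring of p-integral rationals\<close>

text \<open>The reduced denominator divides every other denominator of \<open>x\<close>, so any
  fraction with denominator prime to \<open>p\<close> certifies membership.\<close>

lemma Z_loc_iff:
  assumes "prime p"
  shows "x \<in> Z_loc p \<longleftrightarrow> (\<exists>a b. x = of_int a / of_int b \<and> \<not> int p dvd b)"
proof
  assume "x \<in> Z_loc p"
  then show "\<exists>a b. x = of_int a / of_int b \<and> \<not> int p dvd b"
    by (metis (mono_tags) Z_loc_def mem_Collect_eq prod.collapse quotient_of_div)
next
  assume "\<exists>a b. x = of_int a / of_int b \<and> \<not> int p dvd b"
  then obtain a b where x: "x = of_int a / of_int b" and b: "\<not> int p dvd b"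
    by blast
  obtain c d where q: "quotient_of x = (c, d)"
    by (cases "quotient_of x")
  have d: "d > 0" "coprime c d" "x = of_int c / of_int d"
    using q quotient_of_denom_pos quotient_of_coprime quotient_of_div by auto
  have "b \<noteq> 0" using b by auto
  then have "of_int (a * d) = (of_int (c * b) :: rat)"
    using x d by (simp add: field_simps)
  then have "a * d = c * b"
    by (simp only: of_int_eq_iff)
  then have "d dvd c * b"
    by (metis dvd_triv_right)
  then have "d dvd b"
    using d(2) by (simp add: coprime_commute coprime_dvd_mult_right_iff)
  then show "x \<in> Z_loc p"
    using b q by (auto simp: Z_loc_def dest: dvd_trans)
qed

locale prime_localization =
  fixes p :: nat
  assumes prime: "prime p"
begin

abbreviation cong_p (infix "\<equiv>\<^sub>p" 50) where
  "x \<equiv>\<^sub>p y \<equiv> cong_loc p x y"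

lemma prime_int: "prime (int p)"
  using prime by simp

lemma of_int_mem [simp]: "of_int a \<in> Z_loc p"
  unfolding Z_loc_iff[OF prime] by (rule exI[of _ a], rule exI[of _ 1]) (use prime_int in auto)

lemma of_nat_mem [simp]: "of_nat a \<in> Z_loc p"
  using of_int_mem[of "int a"] by simp

lemma zero_mem [simp]: "0 \<in> Z_loc p" and one_mem [simp]: "1 \<in> Z_loc p"
  and numeral_mem [simp]: "numeral v \<in> Z_loc p"
  using of_nat_mem[of 0] of_nat_mem[of 1] of_nat_mem[of "numeral v"] by simp_all

lemma add_mem [intro, simp]: "x + y \<in> Z_loc p"
  and mult_mem [intro, simp]: "x * y \<in> Z_loc p" if xy: "x \<in> Z_loc p" "y \<in> Z_loc p"
proof -
  from xy obtain a b c d where x: "x = of_int a / of_int b" "\<not> int p dvd b"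
    and y: "y = of_int c / of_int d" "\<not> int p dvd d"
    unfolding Z_loc_iff[OF prime] by blast
  have bd: "\<not> int p dvd b * d"
    using x y prime_int by (simp add: prime_dvd_mult_iff)
  have nz: "b \<noteq> 0" "d \<noteq> 0"
    using x y by auto
  show "x * y \<in> Z_loc p"
    unfolding Z_loc_iff[OF prime] by (intro exI[of _ "a * c"] exI[of _ "b * d"]) (use bd in \<open>simp add: x y\<close>)
  show "x + y \<in> Z_loc p"
    unfolding Z_loc_iff[OF prime] by (intro exI[of _ "a * d + c * b"] exI[of _ "b * d"])
      (use bd nz in \<open>simp add: x y field_simps\<close>)
qed

lemma uminus_mem [intro, simp]: "x \<in> Z_loc p \<Longrightarrow> - x \<in> Z_loc p"
  using mult_mem[OF of_int_mem[of "- 1"], of x] by simp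

lemma diff_mem [intro, simp]: "x \<in> Z_loc p \<Longrightarrow> y \<in> Z_loc p \<Longrightarrow> x - y \<in> Z_loc p"
  using add_mem[of x "- y"] by simp

lemma power_mem [intro, simp]: "x \<in> Z_loc p \<Longrightarrow> x ^ n \<in> Z_loc p"
  by (induction n) auto

lemma sum_mem [intro, simp]: "(\<And>i. i \<in> A \<Longrightarrow> f i \<in> Z_loc p) \<Longrightarrow> sum f A \<in> Z_loc p"
  by (induction A rule: infinite_finite_induct) auto

lemma cong_loc_iff: "x \<equiv>\<^sub>p y \<longleftrightarrow> x \<in> Z_loc p \<and> y \<in> Z_loc p \<and> (\<exists>z\<in>Z_loc p. x - y = of_nat p * z)"
  by (rule cong_loc_def)

lemma cong_locD: "x \<equiv>\<^sub>p y \<Longrightarrow> x \<in> Z_loc p" "x \<equiv>\<^sub>p y \<Longrightarrow> y \<in> Z_loc p"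
  by (auto simp: cong_loc_iff)

lemma cong_loc_refl [simp]: "x \<in> Z_loc p \<Longrightarrow> x \<equiv>\<^sub>p x"
  by (auto simp: cong_loc_iff intro: bexI[of _ 0])

lemma cong_loc_sym: "x \<equiv>\<^sub>p y \<Longrightarrow> y \<equiv>\<^sub>p x"
  unfolding cong_loc_iff by (metis minus_diff_eq mult_minus_right uminus_mem)

lemma cong_loc_add:
  assumes "x \<equiv>\<^sub>p y" "x' \<equiv>\<^sub>p y'"
  shows "x + x' \<equiv>\<^sub>p y + y'"
proof -
  obtain z z' where "z \<in> Z_loc p" "z' \<in> Z_loc p" "x - y = of_nat p * z" "x' - y' = of_nat p * z'"
    using assms unfolding cong_loc_iff by blast
  then have "z + z' \<in> Z_loc p" "x + x' - (y + y') = of_nat p * (z + z')"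
    by (auto simp: algebra_simps)
  then show ?thesis
    using assms unfolding cong_loc_iff by blast
qed

lemma cong_loc_trans [trans]:
  assumes "x \<equiv>\<^sub>p y" "y \<equiv>\<^sub>p z"
  shows "x \<equiv>\<^sub>p z"
proof -
  obtain a b where "a \<in> Z_loc p" "b \<in> Z_loc p" "x - y = of_nat p * a" "y - z = of_nat p * b"
    using assms unfolding cong_loc_iff by blast
  then have "a + b \<in> Z_loc p" "x - z = of_nat p * (a + b)"
    by (auto simp: algebra_simps)
  then show ?thesis
    using assms unfolding cong_loc_iff by blast
qed

lemma cong_loc_mult_left: "x \<equiv>\<^sub>p y \<Longrightarrow> z \<in> Z_loc p \<Longrightarrow> z * x \<equiv>\<^sub>p z * y"
  unfolding cong_loc_iff by (metis mult.left_commute mult_mem right_diff_distrib)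

lemma cong_loc_diff: "x \<equiv>\<^sub>p y \<Longrightarrow> x' \<equiv>\<^sub>p y' \<Longrightarrow> x - x' \<equiv>\<^sub>p y - y'"
  using cong_loc_add[of x y "(- 1) * x'" "(- 1) * y'"] cong_loc_mult_left[of x' y' "- 1"] by simp

lemma cong_loc_mult: "x \<equiv>\<^sub>p y \<Longrightarrow> x' \<equiv>\<^sub>p y' \<Longrightarrow> x * x' \<equiv>\<^sub>p y * y'"
  by (metis cong_loc_mult_left cong_loc_trans cong_locD mult.commute)

lemma cong_loc_power: "x \<equiv>\<^sub>p y \<Longrightarrow> x ^ n \<equiv>\<^sub>p y ^ n"
  by (induction n) (auto intro: cong_loc_mult)

lemma cong_loc_sum: "(\<And>i. i \<in> A \<Longrightarrow> f i \<equiv>\<^sub>p g i) \<Longrightarrow> sum f A \<equiv>\<^sub>p sum g A"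
  by (induction A rule: infinite_finite_induct) (auto intro: cong_loc_add)

lemma cong_loc_of_nat_0: "p dvd n \<Longrightarrow> of_nat n \<equiv>\<^sub>p 0"
  by (auto simp: cong_loc_iff elim!: dvdE)

lemma cong_loc_of_int_0: "int p dvd n \<Longrightarrow> of_int n \<equiv>\<^sub>p 0"
  by (auto simp: cong_loc_iff elim!: dvdE)

text \<open>The ring is local with maximal ideal generated by \<open>p\<close>: if \<open>x\<close>
  is outside that ideal, \<open>p\<close> does not divide its numerator, so the inverted fraction is
  again admissible.\<close>

lemma inverse_mem:
  assumes "x \<in> Z_loc p" "\<not> x \<equiv>\<^sub>p 0"
  shows "x \<noteq> 0" "1 / x \<in> Z_loc p"
proof -
  show "x \<noteq> 0"
    using assms by auto
  obtain a b where x: "x = of_int a / of_int b" "\<not> int p dvd b"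
    using assms(1) unfolding Z_loc_iff[OF prime] by blast
  have "\<not> int p dvd a"
  proof
    assume "int p dvd a"
    moreover have "1 / of_int b \<in> Z_loc p"
      unfolding Z_loc_iff[OF prime] by (rule exI[of _ 1], rule exI[of _ b]) (simp add: x)
    ultimately have "1 / of_int b * of_int a \<equiv>\<^sub>p 1 / of_int b * 0"
      by (intro cong_loc_mult_left cong_loc_of_int_0)
    with assms(2) show False
      by (simp add: x)
  qed
  then show "1 / x \<in> Z_loc p"
    unfolding Z_loc_iff[OF prime] by (intro exI[of _ b] exI[of _ a]) (simp add: x)
qed

lemma cong_loc_mult_cancel:
  assumes "x \<in> Z_loc p" "\<not> x \<equiv>\<^sub>p 0" "x * y \<equiv>\<^sub>p x * z"
  shows "y \<equiv>\<^sub>p z"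
  using cong_loc_mult_left[OF assms(3), of "1 / x"] inverse_mem[OF assms(1,2)] by simp

lemma of_int_cong_loc_0D:
  assumes "of_int n \<equiv>\<^sub>p 0"
  shows "int p dvd n"
proof -
  obtain z where "z \<in> Z_loc p" and z: "of_int n = of_nat p * z"
    using assms unfolding cong_loc_iff by auto
  then obtain a b where ab: "z = of_int a / of_int b" "\<not> int p dvd b"
    unfolding Z_loc_iff[OF prime] by blast
  then have "z * of_int b = of_int a"
    by auto
  with z have "(of_int (n * b) :: rat) = of_int (int p * a)"
    by simp
  then have "n * b = int p * a"
    by (simp only: of_int_eq_iff)
  then have "int p dvd n * b"
    by (rule dvdI)
  then show ?thesis
    using ab(2) prime_int by (simp add: prime_dvd_mult_iff)
qed

section \<open>Fermat's little theorem and binomials divisible by \<open>p\<close>\<close>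

text \<open>Naturals are handled by induction with the binomial theorem, integers by reduction to a
  residue, and a fraction \<open>a / b\<close> by clearing the unit \<open>b\<close>.\<close>

lemma fermat:
  assumes "x \<in> Z_loc p"
  shows "x ^ p \<equiv>\<^sub>p x"
proof -
  have nat: "of_nat c ^ p \<equiv>\<^sub>p of_nat c" for c
  proof (induction c)
    case 0
    then show ?case
      using prime_gt_0_nat[OF prime] by (simp add: zero_power)
  next
    case (Suc c)
    have coeff: "of_nat (p choose k) * of_nat c ^ k \<equiv>\<^sub>p (if k = 0 then 1 else 0)" if "k < p" for k
    proof (cases "k = 0")
      case False
      then have "of_nat (p choose k) * of_nat c ^ k \<equiv>\<^sub>p 0 * of_nat c ^ k"
        using that prime by (intro cong_loc_mult cong_loc_of_nat_0 dvd_choose_prime) auto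
      then show ?thesis
        using False by simp
    qed simp
    have "(of_nat (Suc c) :: rat) ^ p = (\<Sum>k<Suc p. of_nat (p choose k) * of_nat c ^ k)"
      using binomial_ring[of "of_nat c :: rat" 1 p] by (simp add: lessThan_Suc_atMost add.commute)
    also have "\<dots> = (\<Sum>k<p. of_nat (p choose k) * of_nat c ^ k) + of_nat c ^ p"
      by simp
    also have "\<dots> \<equiv>\<^sub>p (\<Sum>k<p. if k = 0 then 1 else 0) + of_nat c"
      using coeff Suc by (intro cong_loc_add cong_loc_sum) auto
    also have "\<dots> = of_nat (Suc c)"
      using prime_gt_0_nat[OF prime] by simp
    finally show ?case .
  qed
  have int: "of_int a ^ p \<equiv>\<^sub>p of_int a" for a
  proof -
    define c where "c = nat (a mod int p)"
    have c: "int c = a mod int p"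
      using prime_gt_0_nat[OF prime] by (simp add: c_def)
    have "int p dvd a - int c"
      unfolding c by simp
    then have "of_int (a - int c) + of_nat c \<equiv>\<^sub>p 0 + of_nat c"
      by (intro cong_loc_add cong_loc_of_int_0) auto
    then have ac: "of_int a \<equiv>\<^sub>p of_nat c"
      by simp
    show ?thesis
      by (rule cong_loc_trans[OF cong_loc_power[OF ac] cong_loc_trans[OF nat cong_loc_sym[OF ac]]])
  qed
  obtain a b where x: "x = of_int a / of_int b" "\<not> int p dvd b"
    using assms unfolding Z_loc_iff[OF prime] by blast
  then have "b \<noteq> 0"
    by auto
  then have xb: "x * of_int b = of_int a"
    using x(1) by simp
  have b: "of_int b \<in> Z_loc p" "\<not> of_int b \<equiv>\<^sub>p 0"
    using x(2) of_int_cong_loc_0D[of b] by auto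
  \<comment> \<open>With \<open>x * b = a\<close>, the chain is \<open>b * x^p\<close>,
    \<open>b^p * x^p = a^p\<close>, \<open>a = b * x\<close>; then \<open>b\<close> is
    cancelled.\<close>
  have "of_int b * x ^ p \<equiv>\<^sub>p of_int b ^ p * x ^ p"
    using assms by (intro cong_loc_mult[OF cong_loc_sym[OF int]]) auto
  also have "of_int b ^ p * x ^ p = of_int a ^ p"
    unfolding xb[symmetric] power_mult_distrib by (rule mult.commute)
  also have "of_int a ^ p \<equiv>\<^sub>p of_int a"
    by (rule int)
  also have "of_int a = of_int b * x"
    by (simp only: xb[symmetric] mult.commute)
  finally show ?thesis
    by (rule cong_loc_mult_cancel[OF b])
qed

text \<open>A case of Lucas' theorem: the last base-\<open>p\<close> digit \<open>l\<close> of the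
  top is smaller than \<open>r\<close>. Pascal's rule splits the coefficient into two that satisfy
  the same bounds.\<close>

lemma prime_dvd_binomial_add:
  assumes "l < r" "r < p"
  shows "p dvd (p + l choose r)"
  using assms
proof (induction l arbitrary: r)
  case 0
  then show ?case
    using prime by (auto intro: dvd_choose_prime)
next
  case (Suc l)
  then obtain s where "r = Suc s"
    by (cases r) auto
  with Suc show ?case
    by auto
qed

lemma one_not_cong_loc_0: "\<not> 1 \<equiv>\<^sub>p 0"
  using of_int_cong_loc_0D[of 1] prime_int by auto

lemma not_cong_loc_0_mult:
  assumes "x \<in> Z_loc p" "\<not> x \<equiv>\<^sub>p 0" "\<not> y \<equiv>\<^sub>p 0"
  shows "\<not> x * y \<equiv>\<^sub>p 0"
  using cong_loc_mult_cancel[OF assms(1,2), of y 0] assms(3) by auto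

lemma not_cong_loc_0_power:
  assumes "x \<in> Z_loc p" "\<not> x \<equiv>\<^sub>p 0"
  shows "\<not> x ^ n \<equiv>\<^sub>p 0"
  by (induction n) (use assms one_not_cong_loc_0 in \<open>auto dest: not_cong_loc_0_mult\<close>)

lemma not_cong_loc_0_inverse:
  assumes "x \<in> Z_loc p" "\<not> x \<equiv>\<^sub>p 0"
  shows "\<not> 1 / x \<equiv>\<^sub>p 0"
  using cong_loc_mult_left[OF _ assms(1), of "1 / x" 0] one_not_cong_loc_0 inverse_mem[OF assms]
  by auto

section \<open>Truncated power series modulo \<open>p\<close>\<close>

text \<open>The full series would be \<open>t^r / (1 - t)^(r + 1)\<close>. Truncating to one period
  multiplies it by \<open>1 - t^p\<close>, which is congruent to \<open>1 - t\<close> by Fermat, so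
  one factor of the denominator is lost.\<close>

lemma sum_binomial_power:
  assumes "r < p" and t: "t \<in> Z_loc p" "\<not> 1 - t \<equiv>\<^sub>p 0"
  shows "(1 - t) ^ r * (\<Sum>j<p. of_nat (j choose r) * t ^ j) \<equiv>\<^sub>p t ^ r"
  using assms(1)
proof (induction r)
  case 0
  have "(1 - t) * (\<Sum>j<p. t ^ j) = 1 - t ^ p"
    by (simp add: one_diff_power_eq)
  also have "1 - t ^ p \<equiv>\<^sub>p (1 - t) * 1"
    using cong_loc_diff[OF cong_loc_refl fermat] t by simp
  finally show ?case
    using cong_loc_mult_cancel[of "1 - t"] t by simp
next
  case (Suc r)
  define U where "U = (\<lambda>r. \<Sum>j<p. of_nat (j choose r) * t ^ j)"
  \<comment> \<open>An exact identity from Pascal's rule. At \<open>N = p\<close> its boundary term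
    vanishes modulo \<open>p\<close>, since \<open>0 < Suc r < p\<close>.\<close>
  have rec: "(1 - t) * (\<Sum>j<N. of_nat (j choose Suc r) * t ^ j)
      = t * (\<Sum>j<N. of_nat (j choose r) * t ^ j) - of_nat (N choose Suc r) * t ^ N" for N
  proof (induction N)
    case (Suc N)
    show ?case
      unfolding sum.lessThan_Suc distrib_left Suc by (simp add: algebra_simps)
  qed simp
  have U: "U r \<in> Z_loc p" for r
    using t by (auto simp: U_def)
  have "(1 - t) * U (Suc r) = t * U r - of_nat (p choose Suc r) * t ^ p"
    using rec[of p] by (simp add: U_def)
  also have "\<dots> \<equiv>\<^sub>p t * U r - 0 * t ^ p"
    using t U Suc.prems prime by (intro cong_loc_diff cong_loc_mult cong_loc_of_nat_0 cong_loc_refl) (auto intro!: dvd_choose_prime)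
  finally have "(1 - t) ^ r * ((1 - t) * U (Suc r)) \<equiv>\<^sub>p (1 - t) ^ r * (t * U r)"
    using t by (intro cong_loc_mult_left) auto
  also have "(1 - t) ^ r * (t * U r) = t * ((1 - t) ^ r * U r)"
    by simp
  also have "\<dots> \<equiv>\<^sub>p t * t ^ r"
    using Suc t by (intro cong_loc_mult_left) (auto simp: U_def)
  finally show ?case
    by (simp add: U_def mult_ac)
qed

text \<open>Substituting \<open>j = n + k\<close> gives the window from \<open>2 * k\<close> to
  \<open>p - 1 + k\<close>. Terms below it are zero and those with \<open>j \<ge> p\<close> vanish
  modulo \<open>p\<close>, so the window may be replaced by \<open>j < p\<close>; the unit
  \<open>t^(2 * k)\<close> is then cancelled.\<close>

lemma sum_binomial_even:
  assumes "2 * k < p" and t: "t \<in> Z_loc p" "\<not> t \<equiv>\<^sub>p 0" "\<not> 1 - t \<equiv>\<^sub>p 0"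
  shows "(1 - t) ^ (2 * k) * (\<Sum>n=k..p - 1. of_nat ((n + k) choose (2 * k)) * t ^ (n - k)) \<equiv>\<^sub>p 1"
proof -
  define b where "b = (\<lambda>j. of_nat (j choose (2 * k)) * t ^ j)"
  have b: "b j \<in> Z_loc p" for j
    using t by (auto simp: b_def)
  have ext: "(\<Sum>j<p + l. b j) \<equiv>\<^sub>p (\<Sum>j<p. b j)" if "l \<le> k" for l
    using that
  proof (induction l)
    case (Suc l)
    then have "p dvd (p + l choose (2 * k))"
      using assms(1) by (intro prime_dvd_binomial_add) auto
    then have "b (p + l) \<equiv>\<^sub>p 0 * t ^ (p + l)"
      unfolding b_def using t by (intro cong_loc_mult cong_loc_of_nat_0) auto
    with Suc have "(\<Sum>j<p + l. b j) + b (p + l) \<equiv>\<^sub>p (\<Sum>j<p. b j) + 0"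
      by (intro cong_loc_add) auto
    then show ?case
      by simp
  qed (use b in auto)
  define S where "S = (\<Sum>n=k..p - 1. of_nat ((n + k) choose (2 * k)) * t ^ (n - k))"
  have "t ^ (2 * k) * S = (\<Sum>n=k..p - 1. b (n + k))"
    unfolding S_def sum_distrib_left b_def
    by (rule sum.cong) (auto simp: add.commute simp flip: power_add)
  also have "\<dots> = (\<Sum>j=k + k..p - 1 + k. b j)"
    by (simp only: sum.shift_bounds_cl_nat_ivl)
  also have "\<dots> = (\<Sum>j<p + k. b j)"
    by (rule sum.mono_neutral_left) (use prime_gt_0_nat[OF prime] in \<open>auto simp: b_def\<close>)
  also have "\<dots> \<equiv>\<^sub>p (\<Sum>j<p. b j)"
    by (rule ext) simp
  finally have "(1 - t) ^ (2 * k) * (t ^ (2 * k) * S) \<equiv>\<^sub>p (1 - t) ^ (2 * k) * (\<Sum>j<p. b j)"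
    using t by (intro cong_loc_mult_left) auto
  also have "\<dots> \<equiv>\<^sub>p t ^ (2 * k)"
    unfolding b_def using assms by (intro sum_binomial_power) auto
  finally have "t ^ (2 * k) * ((1 - t) ^ (2 * k) * S) \<equiv>\<^sub>p t ^ (2 * k) * 1"
    by (simp add: mult_ac)
  then show ?thesis
    unfolding S_def using cong_loc_mult_cancel[OF power_mem not_cong_loc_0_power] t by blast
qed

text \<open>Because \<open>e k\<close> vanishes modulo \<open>p\<close> once
  \<open>2 * k \<ge> p\<close>, the sum may stop at any \<open>K\<close> from
  \<open>(p - 1) div 2\<close> to \<open>p - 1\<close>. This freedom covers the different ranges of
  the two right-hand sides.\<close>

lemma truncated_series:
  assumes m: "m \<in> Z_loc p" "\<not> m \<equiv>\<^sub>p 0" and c: "c \<in> Z_loc p" "\<not> c \<equiv>\<^sub>p 0" and mc: "\<not> m - c \<equiv>\<^sub>p 0"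
    and e: "\<And>k. e k \<in> Z_loc p" "\<And>k. p \<le> 2 * k \<Longrightarrow> k < p \<Longrightarrow> e k \<equiv>\<^sub>p 0"
    and v: "\<And>n. v n = (\<Sum>k\<le>n. of_nat ((n + k) choose (2 * k)) * e k * c ^ (n - k))"
    and K: "(p - 1) div 2 \<le> K" "K < p"
  shows "(\<Sum>n=0..p - 1. v n / m ^ n) \<equiv>\<^sub>p (\<Sum>k=0..K. e k / ((m - c)\<^sup>2 / m) ^ k)"
proof -
  note m_inv = inverse_mem[OF m]
  define t where "t = c * (1 / m)"
  have t: "t \<in> Z_loc p" "\<not> t \<equiv>\<^sub>p 0"
    using mult_mem[OF c(1) m_inv(2)] not_cong_loc_0_mult[OF c not_cong_loc_0_inverse[OF m]]
    by (simp_all only: t_def not_False_eq_True)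
  have t1: "1 - t = (m - c) * (1 / m)"
    using m_inv by (simp add: t_def field_simps)
  have "\<not> 1 - t \<equiv>\<^sub>p 0"
    unfolding t1 by (rule not_cong_loc_0_mult[OF diff_mem[OF m(1) c(1)] mc not_cong_loc_0_inverse[OF m]])
  note t = t this
  have t1_mem: "1 - t \<in> Z_loc p"
    using t by simp
  note t1_inv = inverse_mem[OF t1_mem t(3)]
  define S where "S = (\<lambda>k. \<Sum>n=k..p - 1. of_nat ((n + k) choose (2 * k)) * t ^ (n - k))"
  have S: "S k \<in> Z_loc p" for k
    using t by (auto simp: S_def)
  have "(\<Sum>n\<le>p - 1. v n / m ^ n)
      = (\<Sum>n\<le>p - 1. \<Sum>k\<le>p - 1. of_nat ((n + k) choose (2 * k)) * e k * c ^ (n - k) / m ^ n)"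
    \<comment> \<open>For \<open>k > n\<close> the binomial coefficient is zero, so the inner range
      can be made independent of \<open>n\<close> and the sums exchanged.\<close>
    unfolding v sum_divide_distrib
    by (intro sum.cong refl sum.mono_neutral_left) auto
  also have "\<dots> = (\<Sum>k\<le>p - 1. \<Sum>n\<le>p - 1. of_nat ((n + k) choose (2 * k)) * e k * c ^ (n - k) / m ^ n)"
    by (rule sum.swap)
  also have "\<dots> = (\<Sum>k\<le>p - 1. e k * (1 / m) ^ k * S k)"
  proof (rule sum.cong[OF refl])
    fix k
    have "(\<Sum>n\<le>p - 1. of_nat ((n + k) choose (2 * k)) * e k * c ^ (n - k) / m ^ n)
        = (\<Sum>n=k..p - 1. of_nat ((n + k) choose (2 * k)) * e k * c ^ (n - k) / m ^ n)"
      by (rule sum.mono_neutral_right) auto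
    also have "\<dots> = e k * (1 / m) ^ k * S k"
      unfolding S_def sum_distrib_left
    proof (rule sum.cong[OF refl])
      fix n
      assume "n \<in> {k..p - 1}"
      then obtain i where "n = k + i"
        using le_Suc_ex by auto
      then show "of_nat ((n + k) choose (2 * k)) * e k * c ^ (n - k) / m ^ n
          = e k * (1 / m) ^ k * (of_nat ((n + k) choose (2 * k)) * t ^ (n - k))"
        by (simp add: t_def power_add power_divide)
    qed
    finally show "(\<Sum>n\<le>p - 1. of_nat ((n + k) choose (2 * k)) * e k * c ^ (n - k) / m ^ n)
        = e k * (1 / m) ^ k * S k" .
  qed
  also have "\<dots> \<equiv>\<^sub>p (\<Sum>k\<le>p - 1. if k \<le> K then e k / ((m - c)\<^sup>2 / m) ^ k else 0)"
  proof (rule cong_loc_sum)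
    fix k
    assume "k \<in> {..p - 1}"
    then have k: "k < p"
      using prime_gt_0_nat[OF prime] by auto
    \<comment> \<open>Rewriting the denominator as \<open>m * (1 - t)\<^sup>2\<close> exhibits it as
      a product of units.\<close>
    have eq: "e k / ((m - c)\<^sup>2 / m) ^ k = e k * (1 / m) ^ k * (1 / (1 - t)) ^ (2 * k)"
    proof -
      have "((m - c)\<^sup>2 / m) = m * (1 - t)\<^sup>2"
        using m_inv by (simp add: t1 power2_eq_square)
      then show ?thesis
        by (simp add: power_mult_distrib power_mult power_divide)
    qed
    have small: "e k * (1 / m) ^ k * z \<equiv>\<^sub>p 0" if "p \<le> 2 * k" "z \<in> Z_loc p" for z
    proof -
      have "((1 / m) ^ k * z) * e k \<equiv>\<^sub>p ((1 / m) ^ k * z) * 0"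
        using that m_inv e(2)[OF that(1) k] by (intro cong_loc_mult_left) auto
      then show ?thesis
        by (simp add: mult_ac)
    qed
    show "e k * (1 / m) ^ k * S k \<equiv>\<^sub>p (if k \<le> K then e k / ((m - c)\<^sup>2 / m) ^ k else 0)"
    proof (cases "p \<le> 2 * k")
      \<comment> \<open>Both the left side and the quotient on the right are congruent to 0, so it
        does not matter whether \<open>k \<le> K\<close>.\<close>
      case True
      have "e k * (1 / m) ^ k * (1 / (1 - t)) ^ (2 * k) \<equiv>\<^sub>p 0"
        using True t1_inv by (intro small) auto
      then show ?thesis
        unfolding eq using small[OF True S] by (auto intro: cong_loc_trans cong_loc_sym)
    next
      case False
      then have "(1 / (1 - t)) ^ (2 * k) * ((1 - t) ^ (2 * k) * S k) \<equiv>\<^sub>p (1 / (1 - t)) ^ (2 * k) * 1"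
        unfolding S_def using t t1_inv by (intro cong_loc_mult_left sum_binomial_even) auto
      moreover have "(1 / (1 - t)) ^ (2 * k) * (1 - t) ^ (2 * k) = 1"
        using t1_inv(1) by (simp flip: power_mult_distrib)
      ultimately have "S k \<equiv>\<^sub>p (1 / (1 - t)) ^ (2 * k)"
        by (simp flip: mult.assoc)
      then have "e k * (1 / m) ^ k * S k \<equiv>\<^sub>p e k * (1 / m) ^ k * (1 / (1 - t)) ^ (2 * k)"
        using e m_inv by (intro cong_loc_mult_left) auto
      \<comment> \<open>Now \<open>2 * k < p\<close> forces
        \<open>k \<le> (p - 1) div 2 \<le> K\<close>, which selects the first branch of the
        conditional.\<close>
      then show ?thesis
        using False K unfolding eq by auto
    qed
  qed
  also have "\<dots> = (\<Sum>k\<le>K. e k / ((m - c)\<^sup>2 / m) ^ k)"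
    by (rule sum.mono_neutral_cong_right) (use K in auto)
  finally show ?thesis
    by (simp add: atMost_atLeast0)
qed

text \<open>Write \<open>2 * k = p + (2 * k - p)\<close>; the remainder is less than
  \<open>k\<close> because \<open>k < p\<close>.\<close>

lemma central_binomial_cong_loc_0:
  assumes "p \<le> 2 * k" "k < p"
  shows "of_nat (2 * k choose k) \<equiv>\<^sub>p 0"
  using prime_dvd_binomial_add[of "2 * k - p" k] assms by (intro cong_loc_of_nat_0) auto

end

section \<open>The two congruences\<close>

theorem theorem3p4:
  fixes p :: nat and m :: rat
  assumes "prime p" and "odd p"
    and "m \<in> Z_loc p"
    and "\<not> cong_loc p m 0" and "\<not> cong_loc p m 16" and "\<not> cong_loc p m (-16)"
  shows "cong_loc p
           (\<Sum>n=0..p-1. of_nat (V n) / m^n)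
           (\<Sum>k=0..p-1. of_nat ((2 * k) choose k) * of_nat (G k) / (32 + m + 256 / m)^k)
       \<and> cong_loc p
           (\<Sum>k=0..p-1. of_nat ((2 * k) choose k) * of_nat (G k) / (32 + m + 256 / m)^k)
           (\<Sum>k=0..(p-1) div 2. of_nat (((2 * k) choose k)^3) / (32 - m - 256 / m)^k)"
proof -
  interpret prime_localization p
    by standard (rule assms(1))
  have "p \<noteq> 2"
    using assms(2) by auto
  then have "\<not> p dvd 2"
    using primes_dvd_imp_eq[OF assms(1) two_is_prime_nat] by blast
  then have "\<not> p dvd 2 ^ 4"
    using prime_dvd_power[OF assms(1)] by blast
  then have "\<not> int p dvd int 16"
    by (simp only: int_dvd_int_iff) simp
  then have unit: "\<not> 16 \<equiv>\<^sub>p 0" "\<not> - 16 \<equiv>\<^sub>p 0"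
    using of_int_cong_loc_0D[of 16] of_int_cong_loc_0D[of "- 16"] by auto
  have not_cong_diff: "\<not> m - c \<equiv>\<^sub>p 0" if "\<not> m \<equiv>\<^sub>p c" "c \<in> Z_loc p" for c
    using cong_loc_add[OF _ cong_loc_refl[OF that(2)], of "m - c" 0] that(1) by auto
  have m0: "m \<noteq> 0"
    using assms(4) by auto
  have central: "central_binomial k \<in> Z_loc p" "p \<le> 2 * k \<Longrightarrow> k < p \<Longrightarrow> central_binomial k \<equiv>\<^sub>p 0" for k
    using central_binomial_cong_loc_0[of k] by (simp_all add: central_binomial_def)
  let ?S = "\<Sum>n=0..p - 1. of_nat (V n) / m ^ n"
  \<comment> \<open>The instance \<open>c = -16\<close>, \<open>K = p - 1\<close>.\<close>
  have "?S \<equiv>\<^sub>p (\<Sum>k=0..p - 1. central_binomial k * of_nat (G k) / ((m - (- 16))\<^sup>2 / m) ^ k)"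
  proof (rule truncated_series)
    show "central_binomial k * of_nat (G k) \<equiv>\<^sub>p 0" if "p \<le> 2 * k" "k < p" for k
      using cong_loc_mult[OF central(2)[OF that] cong_loc_refl[OF of_nat_mem[of "G k"]]] by simp
    show "of_nat (V n) = (\<Sum>k\<le>n. of_nat ((n + k) choose (2 * k)) * (central_binomial k * of_nat (G k)) * (- 16) ^ (n - k))" for n
      using V_eq_sum_G[of n] by (simp only: binomial_diag_def)
  qed (use assms(3-6) unit central(1) not_cong_diff[of "- 16"] prime_gt_0_nat[OF prime] in auto)
  also have "(m - (- 16))\<^sup>2 / m = 32 + m + 256 / m"
    using m0 by (simp add: field_simps power2_eq_square)
  finally have G: "?S \<equiv>\<^sub>p (\<Sum>k=0..p - 1. of_nat ((2 * k) choose k) * of_nat (G k) / (32 + m + 256 / m) ^ k)"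
    by (simp only: central_binomial_def)
  \<comment> \<open>The instance \<open>c = 16\<close> with the shortest admissible range,
    \<open>K = (p - 1) div 2\<close>.\<close>
  have "?S \<equiv>\<^sub>p (\<Sum>k=0..(p - 1) div 2. (- 1) ^ k * central_binomial k ^ 3 / ((m - 16)\<^sup>2 / m) ^ k)"
  proof (rule truncated_series)
    show "(- 1) ^ k * central_binomial k ^ 3 \<equiv>\<^sub>p 0" if "p \<le> 2 * k" "k < p" for k
      using cong_loc_mult_left[OF cong_loc_power[OF central(2)[OF that], of 3], of "(- 1) ^ k"] by simp
    show "of_nat (V n) = (\<Sum>k\<le>n. of_nat ((n + k) choose (2 * k)) * ((- 1) ^ k * central_binomial k ^ 3) * 16 ^ (n - k))" for n
      using V_eq_sum_cubes[of n] by (simp only: binomial_diag_def)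
  qed (use assms(3-6) unit central(1) not_cong_diff[of 16] prime_gt_0_nat[OF prime] in auto)
  also have "\<dots> = (\<Sum>k=0..(p - 1) div 2. of_nat (((2 * k) choose k) ^ 3) / (32 - m - 256 / m) ^ k)"
  proof (rule sum.cong[OF refl])
    fix k
    \<comment> \<open>The sign from this denominator cancels the \<open>(-1)^k\<close> of the
      expansion.\<close>
    have "(m - 16)\<^sup>2 / m = - 1 * (32 - m - 256 / m)"
      using m0 by (simp add: field_simps power2_eq_square)
    then have "((m - 16)\<^sup>2 / m) ^ k = (- 1) ^ k * (32 - m - 256 / m) ^ k"
      by (simp only: power_mult_distrib)
    then show "(- 1) ^ k * central_binomial k ^ 3 / ((m - 16)\<^sup>2 / m) ^ k
        = of_nat (((2 * k) choose k) ^ 3) / (32 - m - 256 / m) ^ k"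
      by (simp add: central_binomial_def)
  qed
  finally have "?S \<equiv>\<^sub>p (\<Sum>k=0..(p - 1) div 2. of_nat (((2 * k) choose k) ^ 3) / (32 - m - 256 / m) ^ k)" .
  with G show ?thesis
    using cong_loc_sym[OF G] cong_loc_trans by blast
qed

end
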